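(* Let $K$ be a field and let $Q$ be a finite quiver with $n$ vertices $\{v_1,\dots,v_n\}$. Let $D_1,\dots,D_m$ be the path connected components of $Q$ with $|D_i|=d_i$ for $i=1,\dots,m$. Reorder the vertices so that the first $d_1$ vertices are the vertices in $D_1$, the next $d_2$ vertices are the vertices in $D_2$, ..., the last $d_m$ vertices are the vertices in $D_m$. Then the commuting algebra $KQ/C$ of $KQ$ is in $(d_1,\dots,d_m)$ block form $$\begin{pmatrix}B_{1,1}&B_{1,2}&\cdots&B_{1,m}\\ \vdots&\vdots&&\vdots\\ B_{m,1}&B_{m,2}&\cdots&B_{m,m}\end{pmatrix}$$ with $B_{i,j}=M_{d_i\times d_j}(K)$ if there is a path in $Q$ from some vertex in $D_i$ to a vertex in $D_j$, and $B_{i,j}=M_{d_i\times d_j}(0)$ if there is no path in $Q$ from any vertex in $D_i$ to a vertex in $D_j$.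
   Context: Paths in $Q$ include the paths of length zero (the vertices) and are composed from left to right: a path $p$ from $v$ to $w$ satisfies $vp=p=pw$ in $KQ$. Two paths are parallel if they have the same start vertex and the same end vertex. $C$ is the two-sided ideal of the path algebra $KQ$ generated by all differences $p-q$ of parallel paths $p,q$ (of any lengths $\ge 0$); $KQ/C$ is the commuting algebra of $KQ$. On the vertex set of $Q$ define $v\sim w$ if there are paths from $v$ to $w$ and from $w$ to $v$; this is an equivalence relation, and its equivalence classes are the path connected components of $Q$. $M_{a\times b}(K)$ denotes the $a\times b$ display all of whose entries are $K$, and $M_{a\times b}(0)$ the $a\times b$ display all of whose entries are $0$. An $n\times n$ display of $0$s and $K$s, $n=\sum d_i$, is in $(d_1,\dots,d_m)$ block form if it is partitioned into blocks $B_{i,j}$ of size $d_i\times d_j$, where each $B_{i,i}$ is the $d_i\times d_i$ matrix ring with entries $K$ and each $B_{i,j}$ has all entries $0$ or $K$. That the commuting algebra is in this block form means that $KQ/C$ is isomorphic as a $K$-algebra to the subring of the full $n\times n$ matrix ring $M_n(K)$ consisting of all matrices whose entries are arbitrary in $K$ at positions displayed $K$ and are zero at positions displayed $0$, where the $(k,l)$ position corresponds to $v_k(KQ/C)v_l$. *)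

theory Defs
  imports
    "Graph_Theory.Arc_Walk"
    "HOL-Library.Poly_Mapping"
    "HOL-Algebra.QuotRing"
    "HOL-Algebra.Module"
    "Jordan_Normal_Form.Matrix"
begin

section \<open>Paths and path connected components\<close>

text \<open>A quiver is a \<open>pre_digraph\<close> (loops and multiple arrows allowed); a finite quiver is a
  \<open>fin_digraph\<close>. A path is a triple of its start vertex, its list of arrows (read from left to
  right) and its end vertex. The paths of length zero are the triples \<open>(v, [], v)\<close>.\<close>

type_synonym ('v, 'e) path = "'v \<times> 'e list \<times> 'v"

definition paths :: "('v, 'e) pre_digraph \<Rightarrow> ('v, 'e) path set" where
  "paths Q = {(u, p, v). pre_digraph.awalk Q u p v}"

definition start :: "('v, 'e) path \<Rightarrow> 'v" where
  "start p = fst p"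

definition arrows :: "('v, 'e) path \<Rightarrow> 'e list" where
  "arrows p = fst (snd p)"

definition target :: "('v, 'e) path \<Rightarrow> 'v" where
  "target p = snd (snd p)"

definition trivial_path :: "'v \<Rightarrow> ('v, 'e) path" where
  "trivial_path v = (v, [], v)"

definition concat_path :: "('v, 'e) path \<Rightarrow> ('v, 'e) path \<Rightarrow> ('v, 'e) path" where
  "concat_path p q = (start p, arrows p @ arrows q, target q)"

definition parallel :: "('v, 'e) path \<Rightarrow> ('v, 'e) path \<Rightarrow> bool" where
  "parallel p q \<longleftrightarrow> start p = start q \<and> target p = target q"

definition has_path :: "('v, 'e) pre_digraph \<Rightarrow> 'v \<Rightarrow> 'v \<Rightarrow> bool" where
  "has_path Q v w \<longleftrightarrow> (\<exists>p\<in>paths Q. start p = v \<and> target p = w)"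

definition path_connected_rel :: "('v, 'e) pre_digraph \<Rightarrow> ('v \<times> 'v) set" where
  "path_connected_rel Q =
     {(v, w). v \<in> verts Q \<and> w \<in> verts Q \<and> has_path Q v w \<and> has_path Q w v}"

definition path_connected_components :: "('v, 'e) pre_digraph \<Rightarrow> 'v set set" where
  "path_connected_components Q = verts Q // path_connected_rel Q"


section \<open>The path algebra and the commuting algebra\<close>

text \<open>The elements of \<open>KQ\<close> are the finitely supported functions from paths to \<open>K\<close>; the
  multiplication is the bilinear extension of concatenation, where the product of two paths that
  do not fit together is zero. The field \<open>K\<close> is the universe of the type \<open>'k\<close>.\<close>

definition path_algebra ::
    "('v, 'e) pre_digraph \<Rightarrow> ('k :: field, ('v, 'e) path \<Rightarrow>\<^sub>0 'k) module" where
  "path_algebra Q =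
     \<lparr> carrier = {f. Poly_Mapping.keys f \<subseteq> paths Q},
       monoid.mult = (\<lambda>f g. \<Sum>p\<in>Poly_Mapping.keys f. \<Sum>q\<in>Poly_Mapping.keys g.
                 if target p = start q
                 then Poly_Mapping.single (concat_path p q) (Poly_Mapping.lookup f p * Poly_Mapping.lookup g q)
                 else 0),
       one = (\<Sum>v\<in>verts Q. Poly_Mapping.single (trivial_path v) 1),
       ring.zero = 0,
       add = (+),
       module.smult = (\<lambda>c. Poly_Mapping.map ((*) c)) \<rparr>"

text \<open>\<open>Idl\<close> is the two-sided ideal generated by a set.\<close>

definition commuting_ideal ::
    "('v, 'e) pre_digraph \<Rightarrow> (('v, 'e) path \<Rightarrow>\<^sub>0 'k :: field) set" where
  "commuting_ideal Q = Idl\<^bsub>path_algebra Q\<^esub>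
     {Poly_Mapping.single p 1 - Poly_Mapping.single q 1 | p q.
        p \<in> paths Q \<and> q \<in> paths Q \<and> parallel p q}"

text \<open>\<open>Quot\<close> only yields a ring; the induced scalar multiplication is defined on cosets in the
  same way as \<^const>\<open>rcoset_mult\<close>.\<close>

definition quotient_algebra :: "('k, 'a) module \<Rightarrow> 'a set \<Rightarrow> ('k, 'a set) module" where
  "quotient_algebra A I =
     ring.extend (A Quot I) (module.fields (\<lambda>c X. \<Union>x\<in>X. I +>\<^bsub>A\<^esub> (c \<odot>\<^bsub>A\<^esub> x)))"

definition commuting_algebra ::
    "('v, 'e) pre_digraph \<Rightarrow> ('k :: field, (('v, 'e) path \<Rightarrow>\<^sub>0 'k) set) module" where
  "commuting_algebra Q = quotient_algebra (path_algebra Q) (commuting_ideal Q)"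

definition vertex_class ::
    "('v, 'e) pre_digraph \<Rightarrow> 'v \<Rightarrow> (('v, 'e) path \<Rightarrow>\<^sub>0 'k :: field) set" where
  "vertex_class Q v =
     commuting_ideal Q +>\<^bsub>path_algebra Q\<^esub> Poly_Mapping.single (trivial_path v) 1"


section \<open>Displays and block form\<close>

text \<open>The constructor \<open>K_entry\<close> stands for the symbol \<open>K\<close> in a display, \<open>Zero_entry\<close> for \<open>0\<close>.
  Rows and columns of matrices and lists are indexed from 0.\<close>

datatype entry = Zero_entry | K_entry


type_synonym display = "entry mat"

definition all_K :: "nat \<Rightarrow> nat \<Rightarrow> display" where
  "all_K a b = mat a b (\<lambda>_. K_entry)"

definition all_zero :: "nat \<Rightarrow> nat \<Rightarrow> display" where
  "all_zero a b = mat a b (\<lambda>_. Zero_entry)"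

definition offset :: "nat list \<Rightarrow> nat \<Rightarrow> nat" where
  "offset ds i = (\<Sum>j<i. ds ! j)"

definition block :: "nat list \<Rightarrow> display \<Rightarrow> nat \<Rightarrow> nat \<Rightarrow> display" where
  "block ds B i j =
     mat (ds ! i) (ds ! j) (\<lambda>(a, b). B $$ (offset ds i + a, offset ds j + b))"

definition block_form :: "nat list \<Rightarrow> display \<Rightarrow> bool" where
  "block_form ds B \<longleftrightarrow>
     B \<in> carrier_mat (sum_list ds) (sum_list ds) \<and>
     (\<forall>i<length ds. block ds B i i = all_K (ds ! i) (ds ! i)) \<and>
     (\<forall>i<length ds. \<forall>j<length ds.
        block ds B i j = all_K (ds ! i) (ds ! j) \<or> block ds B i j = all_zero (ds ! i) (ds ! j))"

definition matrix_algebra :: "nat \<Rightarrow> ('k :: field, 'k mat) module" where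
  "matrix_algebra n = ring_mat TYPE('k) n (module.fields (\<cdot>\<^sub>m))"

definition display_algebra :: "nat \<Rightarrow> display \<Rightarrow> ('k :: field, 'k mat) module" where
  "display_algebra n B = (matrix_algebra n)
     \<lparr> carrier := {M \<in> carrier_mat n n.
         \<forall>k<n. \<forall>l<n. B $$ (k, l) = Zero_entry \<longrightarrow> M $$ (k, l) = 0} \<rparr>"

definition algebra_iso :: "('k, 'a) module \<Rightarrow> ('k, 'b) module \<Rightarrow> ('a \<Rightarrow> 'b) set" where
  "algebra_iso A B = {\<phi> \<in> ring_iso A B. \<forall>c. \<forall>x\<in>carrier A. \<phi> (c \<odot>\<^bsub>A\<^esub> x) = c \<odot>\<^bsub>B\<^esub> \<phi> x}"

text \<open>\<open>e ! k\<close> is the element of \<open>A\<close> belonging to the vertex \<open>v\<^sub>k\<close>. The last conjunct says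
  that \<open>v\<^sub>k A v\<^sub>l\<close> corresponds to the \<open>(k, l)\<close> position.\<close>

definition has_display :: "('k :: field, 'a) module \<Rightarrow> 'a list \<Rightarrow> display \<Rightarrow> bool" where
  "has_display A e B \<longleftrightarrow>
     B \<in> carrier_mat (length e) (length e) \<and>
     (\<exists>\<phi>\<in>algebra_iso A (display_algebra (length e) B).
        \<forall>k<length e. \<forall>l<length e.
          \<phi> ` {e ! k \<otimes>\<^bsub>A\<^esub> x \<otimes>\<^bsub>A\<^esub> e ! l | x. x \<in> carrier A} =
          {M \<in> carrier (display_algebra (length e) B).
             \<forall>i<length e. \<forall>j<length e. (i, j) \<noteq> (k, l) \<longrightarrow> M $$ (i, j) = 0})"

end

theory Submission
  imports Defs "HOL-Algebra.Subrings"
begin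

text \<open>Modulo \<open>C\<close> any two parallel paths agree, so the class of an element \<open>f\<close> of \<open>KQ\<close> should depend
  only on the numbers \<open>c\<^sub>v\<^sub>w(f)\<close>, the sum of the coefficients of \<open>f\<close> over all paths from \<open>v\<close> to \<open>w\<close>.
  Cutting a product of paths at the vertex where they meet gives
  \<open>c\<^sub>u\<^sub>w(fg) = \<Sum>\<^sub>v c\<^sub>u\<^sub>v(f) c\<^sub>v\<^sub>w(g)\<close> (\<open>coeff_between_mult\<close>): this is matrix multiplication, and
  \<open>f \<mapsto> (c\<^sub>v\<^sub>w(f))\<close> is a homomorphism from \<open>KQ\<close> to \<open>n \<times> n\<close> matrices (\<open>coeff_mat_ring_hom\<close>). Its
  values vanish at the positions \<open>(v, w)\<close> without a path from \<open>v\<close> to \<open>w\<close>.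

  One chosen path for each pair \<open>(v, w)\<close> that is joined by a path turns every matrix with these zeros
  into an element of \<open>KQ\<close> that is mapped to it (\<open>coeff_mat_surj\<close>). The same choice determines the
  kernel: replacing every path in \<open>f\<close> by the chosen parallel one changes \<open>f\<close> by an element of \<open>C\<close>
  (\<open>diff_lift_coeffs_in_commuting_ideal\<close>), and the result is zero as soon as all \<open>c\<^sub>v\<^sub>w(f)\<close> are.
  Hence the kernel is \<open>C\<close> (\<open>coeff_mat_kernel\<close>), and the homomorphism theorem identifies \<open>KQ/C\<close> with
  the matrices supported on the relation ``there is a path from \<open>v\<close> to \<open>w\<close>''. The trivial path at
  \<open>v\<^sub>k\<close> becomes the \<open>k\<close>-th diagonal matrix unit, which yields the statement on positions.

  The block form is then a property of this relation alone: it is reflexive and transitive, so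
  whether a path from \<open>v\<close> to \<open>w\<close> exists depends only on the path connected components of \<open>v\<close> and
  \<open>w\<close> (\<open>has_path_between_components\<close>), and with the vertices listed component by component each
  block is constant.\<close>

section \<open>Finitely supported functions on paths\<close>

text \<open>The identities between additive maps below are all checked on a single path; the restriction to
  \<open>A\<close> lets the checks use that this path lies in the quiver.\<close>

lemma poly_mapping_induct_on [consumes 1, case_names zero single_plus]:
  fixes f :: "'a \<Rightarrow>\<^sub>0 'b :: ab_group_add"
  assumes "Poly_Mapping.keys f \<subseteq> A"
    and zero: "P 0"
    and step: "\<And>p c f. p \<in> A \<Longrightarrow> Poly_Mapping.keys f \<subseteq> A \<Longrightarrow> P f \<Longrightarrow> P (Poly_Mapping.single p c + f)"
  shows "P f"
proof -
  have "P f" if "finite S" "Poly_Mapping.keys f \<subseteq> S" "S \<subseteq> A" for S f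
    using that
  proof (induction S arbitrary: f rule: finite_induct)
    case empty
    then show ?case using zero by simp
  next
    case (insert p S)
    define g where "g = f - Poly_Mapping.single p (Poly_Mapping.lookup f p)"
    have g: "Poly_Mapping.keys g \<subseteq> S"
      using insert.prems by (auto simp: g_def in_keys_iff lookup_minus lookup_single when_def split: if_splits)
    then have "P g" using insert by blast
    moreover have "f = Poly_Mapping.single p (Poly_Mapping.lookup f p) + g"
      by (simp add: g_def)
    ultimately show ?case
      using step[of p g] g insert.prems by (metis insert_subset subset_trans)
  qed
  with assms(1) show ?thesis by (meson finite_keys subset_refl)
qed

lemma poly_mapping_induct_single_plus [case_names zero single_plus]:
  fixes f :: "'a \<Rightarrow>\<^sub>0 'b :: ab_group_add"
  assumes "P 0" "\<And>p c f. P f \<Longrightarrow> P (Poly_Mapping.single p c + f)"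
  shows "P f"
  using poly_mapping_induct_on[of f UNIV P] assms by simp

lemma lookup_scale:
  "Poly_Mapping.lookup (Poly_Mapping.map ((*) c) f) p = c * Poly_Mapping.lookup f p"
  for c :: "'k :: field"
  by (simp add: Poly_Mapping.map.rep_eq when_def)

lemma scale_single:
  "Poly_Mapping.map ((*) c) (Poly_Mapping.single p a) = Poly_Mapping.single p (c * a)"
  for c :: "'k :: field"
  by (rule poly_mapping_eqI) (simp add: lookup_scale lookup_single when_def)

lemma scale_add:
  "Poly_Mapping.map ((*) c) (f + g) = Poly_Mapping.map ((*) c) f + Poly_Mapping.map ((*) c) g"
  for c :: "'k :: field"
  by (rule poly_mapping_eqI) (simp add: lookup_scale lookup_add distrib_left)

section \<open>The path algebra is a ring\<close>

text \<open>This is the product of \<^const>\<open>path_algebra\<close> as a function of its own. It does not mention the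
  quiver, so bilinearity and associativity need no carrier conditions.\<close>

definition path_mult :: "(('v, 'e) path \<Rightarrow>\<^sub>0 'k :: field) \<Rightarrow> (('v, 'e) path \<Rightarrow>\<^sub>0 'k) \<Rightarrow> (('v, 'e) path \<Rightarrow>\<^sub>0 'k)" where
  "path_mult f g = (\<Sum>p\<in>Poly_Mapping.keys f. \<Sum>q\<in>Poly_Mapping.keys g.
     if target p = start q
     then Poly_Mapping.single (concat_path p q) (Poly_Mapping.lookup f p * Poly_Mapping.lookup g q)
     else 0)"

lemma path_algebra_simps:
  "carrier (path_algebra Q) = {f. Poly_Mapping.keys f \<subseteq> paths Q}"
  "monoid.mult (path_algebra Q) = path_mult"
  "one (path_algebra Q) = (\<Sum>v\<in>verts Q. Poly_Mapping.single (trivial_path v) 1)"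
  "ring.zero (path_algebra Q) = 0"
  "add (path_algebra Q) = (+)"
  "module.smult (path_algebra Q) = (\<lambda>c. Poly_Mapping.map ((*) c))"
  by (simp_all add: path_algebra_def path_mult_def fun_eq_iff)

text \<open>For distributivity: two summands and their sum have different supports in general, and a common
  finite superset as index set makes the three products comparable term by term.\<close>

lemma path_mult_superset:
  assumes "finite A" "Poly_Mapping.keys f \<subseteq> A" "finite B" "Poly_Mapping.keys g \<subseteq> B"
  shows "path_mult f g = (\<Sum>p\<in>A. \<Sum>q\<in>B.
     if target p = start q
     then Poly_Mapping.single (concat_path p q) (Poly_Mapping.lookup f p * Poly_Mapping.lookup g q)
     else 0)"
proof -
  have "path_mult f g = (\<Sum>p\<in>Poly_Mapping.keys f. \<Sum>q\<in>B.
     if target p = start q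
     then Poly_Mapping.single (concat_path p q) (Poly_Mapping.lookup f p * Poly_Mapping.lookup g q)
     else 0)"
    unfolding path_mult_def
    by (intro sum.cong refl sum.mono_neutral_left)
      (use assms in \<open>auto simp: in_keys_iff\<close>)
  also have "\<dots> = (\<Sum>p\<in>A. \<Sum>q\<in>B.
     if target p = start q
     then Poly_Mapping.single (concat_path p q) (Poly_Mapping.lookup f p * Poly_Mapping.lookup g q)
     else 0)"
    by (intro sum.mono_neutral_left)
      (use assms in \<open>auto simp: in_keys_iff intro!: sum.neutral\<close>)
  finally show ?thesis .
qed

lemma path_mult_add_left: "path_mult (f + g) h = path_mult f h + path_mult g h"
proof -
  let ?A = "Poly_Mapping.keys f \<union> Poly_Mapping.keys g"
  have "Poly_Mapping.keys (f + g) \<subseteq> ?A" by (rule keys_add)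
  then show ?thesis
    by (simp add: path_mult_superset[of ?A _ "Poly_Mapping.keys h"] flip: sum.distrib)
      (intro sum.cong refl, simp add: lookup_add distrib_right single_add)
qed

lemma path_mult_add_right: "path_mult h (f + g) = path_mult h f + path_mult h g"
proof -
  let ?A = "Poly_Mapping.keys f \<union> Poly_Mapping.keys g"
  have "Poly_Mapping.keys (f + g) \<subseteq> ?A" by (rule keys_add)
  then show ?thesis
    by (simp add: path_mult_superset[of "Poly_Mapping.keys h" _ ?A] flip: sum.distrib)
      (intro sum.cong refl, simp add: lookup_add distrib_left single_add)
qed

lemma path_mult_zero [simp]: "path_mult 0 g = 0" "path_mult f 0 = 0"
  by (simp_all add: path_mult_def)

lemma path_mult_single:
  "path_mult (Poly_Mapping.single p a) (Poly_Mapping.single q b) =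
    (if target p = start q then Poly_Mapping.single (concat_path p q) (a * b) else 0)"
  by (subst path_mult_superset[of "{p}" _ "{q}"]) auto

lemma path_mult_sum_left: "path_mult (\<Sum>i\<in>I. f i) h = (\<Sum>i\<in>I. path_mult (f i) h)"
  by (induction I rule: infinite_finite_induct) (simp_all add: path_mult_add_left)

lemma path_mult_sum_right: "path_mult h (\<Sum>i\<in>I. f i) = (\<Sum>i\<in>I. path_mult h (f i))"
  by (induction I rule: infinite_finite_induct) (simp_all add: path_mult_add_right)

lemma path_mult_minus_right: "path_mult h (f - g) = path_mult h f - path_mult h g"
  using path_mult_add_right[of h "f - g" g] by (simp add: algebra_simps)

lemma path_simps [simp]:
  "start (concat_path p q) = start p" "target (concat_path p q) = target q"
  "start (trivial_path v) = v" "target (trivial_path v) = v"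
  "concat_path (concat_path p q) r = concat_path p (concat_path q r)"
  "concat_path (trivial_path (start p)) p = p" "concat_path p (trivial_path (target p)) = p"
  by (simp_all add: start_def target_def concat_path_def trivial_path_def arrows_def)

lemma path_mult_assoc: "path_mult (path_mult f g) h = path_mult f (path_mult g h)"
proof (induction f rule: poly_mapping_induct_single_plus)
  case f: (single_plus p a f)
  have "path_mult (path_mult (Poly_Mapping.single p a) g) h = path_mult (Poly_Mapping.single p a) (path_mult g h)"
  proof (induction g rule: poly_mapping_induct_single_plus)
    case g: (single_plus q b g)
    have "path_mult (path_mult (Poly_Mapping.single p a) (Poly_Mapping.single q b)) h
        = path_mult (Poly_Mapping.single p a) (path_mult (Poly_Mapping.single q b) h)"
    proof (induction h rule: poly_mapping_induct_single_plus)
      case (single_plus r c h)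
      moreover have "path_mult (path_mult (Poly_Mapping.single p a) (Poly_Mapping.single q b)) (Poly_Mapping.single r c)
          = path_mult (Poly_Mapping.single p a) (path_mult (Poly_Mapping.single q b) (Poly_Mapping.single r c))"
        by (simp add: path_mult_single mult.assoc)
      ultimately show ?case by (simp add: path_mult_add_right)
    qed simp_all
    then show ?case using g by (simp add: path_mult_add_left path_mult_add_right)
  qed simp_all
  then show ?case using f by (simp add: path_mult_add_left)
qed simp_all

context fin_digraph
begin

lemma start_in_verts: "p \<in> paths G \<Longrightarrow> start p \<in> verts G"
  by (auto simp: paths_def start_def)

lemma target_in_verts: "p \<in> paths G \<Longrightarrow> target p \<in> verts G"
  by (auto simp: paths_def target_def)

lemma trivial_path_in_paths: "v \<in> verts G \<Longrightarrow> trivial_path v \<in> paths G"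
  by (simp add: paths_def trivial_path_def awalk_Nil_iff)

lemma concat_path_in_paths:
  "p \<in> paths G \<Longrightarrow> q \<in> paths G \<Longrightarrow> target p = start q \<Longrightarrow> concat_path p q \<in> paths G"
  by (auto simp: paths_def concat_path_def start_def target_def arrows_def intro: awalk_appendI)

lemma has_path_refl: "v \<in> verts G \<Longrightarrow> has_path G v v"
  unfolding has_path_def by (rule bexI[OF _ trivial_path_in_paths]) simp_all

lemma has_path_trans: "has_path G u v \<Longrightarrow> has_path G v w \<Longrightarrow> has_path G u w"
  unfolding has_path_def by (metis concat_path_in_paths path_simps(1,2))

lemma has_path_in_verts: "has_path G v w \<Longrightarrow> v \<in> verts G \<and> w \<in> verts G"
  by (auto simp: has_path_def start_in_verts target_in_verts)

lemma single_in_path_algebra: "p \<in> paths G \<Longrightarrow> Poly_Mapping.single p c \<in> carrier (path_algebra G)"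
  by (simp add: path_algebra_simps)

lemma sum_in_path_algebra:
  "(\<And>i. i \<in> I \<Longrightarrow> f i \<in> carrier (path_algebra G)) \<Longrightarrow> (\<Sum>i\<in>I. f i) \<in> carrier (path_algebra G)"
  using keys_sum[of f I] by (fastforce simp: path_algebra_simps)

lemma path_mult_closed:
  assumes "f \<in> carrier (path_algebra G)" "g \<in> carrier (path_algebra G)"
  shows "path_mult f g \<in> carrier (path_algebra G)"
  unfolding path_mult_def using assms
  by (intro sum_in_path_algebra) (auto simp: path_algebra_simps dest: concat_path_in_paths)

text \<open>Among the trivial paths, only the one at the start of \<open>p\<close> can be composed with \<open>p\<close>.\<close>

lemma path_mult_one_left:
  assumes "f \<in> carrier (path_algebra G)"
  shows "path_mult (\<Sum>v\<in>verts G. Poly_Mapping.single (trivial_path v) 1) f = f"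
proof -
  have "Poly_Mapping.keys f \<subseteq> paths G" using assms by (simp add: path_algebra_simps)
  then show ?thesis
  proof (induction rule: poly_mapping_induct_on)
    case (single_plus p c f)
    have "path_mult (\<Sum>v\<in>verts G. Poly_Mapping.single (trivial_path v) 1) (Poly_Mapping.single p c)
      = (\<Sum>v\<in>verts G. if v = start p then Poly_Mapping.single p c else 0)"
      by (auto simp: path_mult_sum_left path_mult_single intro!: sum.cong)
    also have "\<dots> = Poly_Mapping.single p c"
      using single_plus.hyps start_in_verts by simp
    finally show ?case using single_plus by (simp add: path_mult_add_right)
  qed simp
qed

lemma path_mult_one_right:
  assumes "f \<in> carrier (path_algebra G)"
  shows "path_mult f (\<Sum>v\<in>verts G. Poly_Mapping.single (trivial_path v) 1) = f"
proof -
  have "Poly_Mapping.keys f \<subseteq> paths G" using assms by (simp add: path_algebra_simps)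
  then show ?thesis
  proof (induction rule: poly_mapping_induct_on)
    case (single_plus p c f)
    have "path_mult (Poly_Mapping.single p c) (\<Sum>v\<in>verts G. Poly_Mapping.single (trivial_path v) 1)
      = (\<Sum>v\<in>verts G. if v = target p then Poly_Mapping.single p c else 0)"
      by (auto simp: path_mult_sum_right path_mult_single intro!: sum.cong)
    also have "\<dots> = Poly_Mapping.single p c"
      using single_plus.hyps target_in_verts by simp
    finally show ?case using single_plus by (simp add: path_mult_add_left)
  qed simp
qed

lemma ring_path_algebra: "ring (path_algebra G :: ('k :: field, ('a, 'b) path \<Rightarrow>\<^sub>0 'k) module)"
  (is "ring ?A")
proof (rule ringI)
  show "abelian_group ?A"
  proof (rule abelian_groupI)
    fix f g assume "f \<in> carrier ?A" "g \<in> carrier ?A"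
    then show "f \<oplus>\<^bsub>?A\<^esub> g \<in> carrier ?A"
      using keys_add[of f g] by (auto simp: path_algebra_simps)
  next
    fix f assume "f \<in> carrier ?A"
    then have "- f \<in> carrier ?A" "- f \<oplus>\<^bsub>?A\<^esub> f = \<zero>\<^bsub>?A\<^esub>"
      by (simp_all add: path_algebra_simps)
    then show "\<exists>g\<in>carrier ?A. g \<oplus>\<^bsub>?A\<^esub> f = \<zero>\<^bsub>?A\<^esub>" by blast
  qed (simp_all add: path_algebra_simps algebra_simps)
  show "monoid ?A"
  proof (rule monoidI)
    show "\<one>\<^bsub>?A\<^esub> \<in> carrier ?A"
      unfolding path_algebra_simps(3)
      by (intro sum_in_path_algebra single_in_path_algebra trivial_path_in_paths)
  qed (use path_mult_closed path_mult_one_left path_mult_one_right in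
      \<open>simp_all add: path_mult_assoc path_algebra_simps(2,3)\<close>)
qed (simp_all add: path_algebra_simps path_mult_add_left path_mult_add_right)

end

section \<open>Sums of coefficients over parallel paths\<close>

definition coeff_between :: "'v \<Rightarrow> 'v \<Rightarrow> (('v, 'e) path \<Rightarrow>\<^sub>0 'k :: field) \<Rightarrow> 'k" where
  "coeff_between v w f =
     (\<Sum>p\<in>Poly_Mapping.keys f. if start p = v \<and> target p = w then Poly_Mapping.lookup f p else 0)"

lemma coeff_between_superset:
  assumes "finite A" "Poly_Mapping.keys f \<subseteq> A"
  shows "coeff_between v w f =
     (\<Sum>p\<in>A. if start p = v \<and> target p = w then Poly_Mapping.lookup f p else 0)"
  unfolding coeff_between_def
  by (intro sum.mono_neutral_left) (use assms in \<open>auto simp: in_keys_iff\<close>)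

lemma coeff_between_zero [simp]: "coeff_between v w 0 = 0"
  by (simp add: coeff_between_def)

lemma coeff_between_single:
  "coeff_between v w (Poly_Mapping.single p c) = (if start p = v \<and> target p = w then c else 0)"
  by (subst coeff_between_superset[of "{p}"]) auto

lemma coeff_between_add: "coeff_between v w (f + g) = coeff_between v w f + coeff_between v w g"
proof -
  let ?A = "Poly_Mapping.keys f \<union> Poly_Mapping.keys g"
  have "Poly_Mapping.keys (f + g) \<subseteq> ?A" by (rule keys_add)
  then show ?thesis
    by (simp add: coeff_between_superset[of ?A] flip: sum.distrib)
      (intro sum.cong refl, simp add: lookup_add)
qed

lemma coeff_between_minus: "coeff_between v w (f - g) = coeff_between v w f - coeff_between v w g"
  using coeff_between_add[of v w "f - g" g] by (simp add: algebra_simps)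

lemma coeff_between_sum: "coeff_between v w (\<Sum>i\<in>I. f i) = (\<Sum>i\<in>I. coeff_between v w (f i))"
  by (induction I rule: infinite_finite_induct) (simp_all add: coeff_between_add)

lemma coeff_between_scale:
  fixes f :: "('v, 'e) path \<Rightarrow>\<^sub>0 'k :: field"
  shows "coeff_between v w (Poly_Mapping.map ((*) c) f) = c * coeff_between v w f"
proof (induction f rule: poly_mapping_induct_single_plus)
  case (single_plus p a f)
  then show ?case
    by (simp add: scale_add scale_single coeff_between_add coeff_between_single distrib_left)
next
  case zero
  have "Poly_Mapping.map ((*) c) 0 = (0 :: ('v, 'e) path \<Rightarrow>\<^sub>0 'k)"
    by (rule poly_mapping_eqI) (simp add: lookup_scale)
  then show ?case by simp
qed

context fin_digraph
begin

lemma coeff_between_eq_0: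
  assumes "f \<in> carrier (path_algebra G)" "\<not> has_path G v w"
  shows "coeff_between v w f = 0"
  unfolding coeff_between_def
  by (rule sum.neutral) (use assms in \<open>auto simp: path_algebra_simps has_path_def\<close>)

text \<open>On single paths \<open>p\<close>, \<open>q\<close> the sum over the middle vertex has at most the term at
  \<open>target p\<close>, and this term is nonzero only if \<open>q\<close> starts there, that is, if \<open>pq\<close> is a path.\<close>

lemma coeff_between_mult:
  assumes f: "f \<in> carrier (path_algebra G)"
  shows "coeff_between u w (path_mult f g) = (\<Sum>v\<in>verts G. coeff_between u v f * coeff_between v w g)"
proof -
  have "Poly_Mapping.keys f \<subseteq> paths G" using f by (simp add: path_algebra_simps)
  then show ?thesis
  proof (induction rule: poly_mapping_induct_on)
    case f: (single_plus p a f)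
    have "coeff_between u w (path_mult (Poly_Mapping.single p a) g)
       = (\<Sum>v\<in>verts G. coeff_between u v (Poly_Mapping.single p a) * coeff_between v w g)"
    proof (induction g rule: poly_mapping_induct_single_plus)
      case (single_plus q b g)
      have "(\<Sum>v\<in>verts G. coeff_between u v (Poly_Mapping.single p a) * coeff_between v w (Poly_Mapping.single q b))
        = (\<Sum>v\<in>verts G. if v = target p then
             (if start p = u \<and> target p = start q \<and> target q = w then a * b else 0) else 0)"
        by (intro sum.cong refl) (auto simp: coeff_between_single)
      also have "\<dots> = coeff_between u w (path_mult (Poly_Mapping.single p a) (Poly_Mapping.single q b))"
        using target_in_verts[OF f(1)] by (auto simp: path_mult_single coeff_between_single)
      finally show ?case using single_plus
        by (simp add: path_mult_add_right coeff_between_add distrib_left sum.distrib)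
    qed simp_all
    then show ?case using f by (simp add: path_mult_add_left coeff_between_add distrib_right sum.distrib)
  qed simp
qed

section \<open>The commuting ideal\<close>

definition chosen_path :: "'a \<Rightarrow> 'a \<Rightarrow> ('a, 'b) path" where
  "chosen_path v w = (SOME p. p \<in> paths G \<and> start p = v \<and> target p = w)"

lemma chosen_path:
  assumes "has_path G v w"
  shows "chosen_path v w \<in> paths G" "start (chosen_path v w) = v" "target (chosen_path v w) = w"
proof -
  have "\<exists>p. p \<in> paths G \<and> start p = v \<and> target p = w"
    using assms by (auto simp: has_path_def)
  then have "chosen_path v w \<in> paths G \<and> start (chosen_path v w) = v \<and> target (chosen_path v w) = w"
    unfolding chosen_path_def by (rule someI_ex)
  then show "chosen_path v w \<in> paths G" "start (chosen_path v w) = v" "target (chosen_path v w) = w"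
    by blast+
qed

text \<open>An element of the path algebra with prescribed sums of coefficients: each value \<open>c v w\<close> is put
  on the chosen path. Values at pairs without a path are dropped, since the sum over no paths is zero.\<close>

definition lift_coeffs :: "('a \<Rightarrow> 'a \<Rightarrow> 'k :: field) \<Rightarrow> (('a, 'b) path \<Rightarrow>\<^sub>0 'k)" where
  "lift_coeffs c = (\<Sum>v\<in>verts G. \<Sum>w\<in>verts G.
     if has_path G v w then Poly_Mapping.single (chosen_path v w) (c v w) else 0)"

lemma lift_coeffs_closed: "lift_coeffs c \<in> carrier (path_algebra G)"
  unfolding lift_coeffs_def
  by (intro sum_in_path_algebra) (auto simp: path_algebra_simps chosen_path)

lemma coeff_between_lift_coeffs:
  assumes "has_path G v w"
  shows "coeff_between v w (lift_coeffs c) = c v w"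
proof -
  have "coeff_between v w (lift_coeffs c) =
    (\<Sum>v'\<in>verts G. \<Sum>w'\<in>verts G. if w' = w then (if v' = v then c v w else 0) else 0)"
    unfolding lift_coeffs_def coeff_between_sum
    by (intro sum.cong refl) (use assms in \<open>auto simp: coeff_between_single chosen_path\<close>)
  also have "\<dots> = c v w"
    using has_path_in_verts[OF assms] by simp
  finally show ?thesis .
qed

lemma lift_coeffs_add: "lift_coeffs (\<lambda>v w. c v w + d v w) = lift_coeffs c + lift_coeffs d"
  unfolding lift_coeffs_def sum.distrib[symmetric]
  by (intro sum.cong refl) (simp add: single_add)

lemma lift_coeffs_single:
  assumes "p \<in> paths G"
  shows "lift_coeffs (\<lambda>v w. coeff_between v w (Poly_Mapping.single p c))
    = Poly_Mapping.single (chosen_path (start p) (target p)) c"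
proof -
  have "has_path G (start p) (target p)" using assms by (auto simp: has_path_def)
  then have "lift_coeffs (\<lambda>v w. coeff_between v w (Poly_Mapping.single p c)) =
    (\<Sum>v\<in>verts G. \<Sum>w\<in>verts G. if w = target p then (if v = start p then
       Poly_Mapping.single (chosen_path (start p) (target p)) c else 0) else 0)"
    unfolding lift_coeffs_def by (intro sum.cong refl) (auto simp: coeff_between_single)
  also have "\<dots> = Poly_Mapping.single (chosen_path (start p) (target p)) c"
    using start_in_verts[OF assms] target_in_verts[OF assms] by simp
  finally show ?thesis .
qed

lemma generators_in_path_algebra:
  "{Poly_Mapping.single p 1 - Poly_Mapping.single q 1 | p q.
     p \<in> paths G \<and> q \<in> paths G \<and> parallel p q}
   \<subseteq> carrier (path_algebra G :: ('k :: field, ('a, 'b) path \<Rightarrow>\<^sub>0 'k) module)"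
proof -
  have "Poly_Mapping.keys (Poly_Mapping.single p (1::'k) - Poly_Mapping.single q 1) \<subseteq> paths G"
    if "p \<in> paths G" "q \<in> paths G" for p q
    using that by (auto simp: in_keys_iff lookup_minus lookup_single when_def split: if_splits)
  then show ?thesis unfolding path_algebra_simps by blast
qed

lemma ideal_commuting_ideal:
  "ideal (commuting_ideal G) (path_algebra G :: ('k :: field, ('a, 'b) path \<Rightarrow>\<^sub>0 'k) module)"
  unfolding commuting_ideal_def
  by (rule ring.genideal_ideal[OF ring_path_algebra generators_in_path_algebra])

text \<open>The ideal is generated by differences with coefficient 1. Multiplication by \<open>c\<close> times the
  trivial path at the common start vertex has the effect of the scalar \<open>c\<close>.\<close>

lemma parallel_difference_in_commuting_ideal:
  assumes "p \<in> paths G" "q \<in> paths G" "parallel p q"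
  shows "Poly_Mapping.single p c - Poly_Mapping.single q c \<in> commuting_ideal G"
proof -
  let ?A = "path_algebra G"
  have "Poly_Mapping.single p 1 - Poly_Mapping.single q 1 \<in> commuting_ideal G"
    unfolding commuting_ideal_def
    using ring.genideal_self[OF ring_path_algebra generators_in_path_algebra] assms by blast
  then have "Poly_Mapping.single (trivial_path (start p)) c
      \<otimes>\<^bsub>?A\<^esub> (Poly_Mapping.single p 1 - Poly_Mapping.single q 1) \<in> commuting_ideal G"
    using ideal.I_l_closed[OF ideal_commuting_ideal] single_in_path_algebra
      trivial_path_in_paths start_in_verts[OF assms(1)] by blast
  moreover have "start q = start p" using assms(3) by (simp add: parallel_def)
  then have "Poly_Mapping.single (trivial_path (start p)) c
      \<otimes>\<^bsub>?A\<^esub> (Poly_Mapping.single p 1 - Poly_Mapping.single q 1)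
      = Poly_Mapping.single p c - Poly_Mapping.single q c"
    using path_simps(6)[of q]
    by (simp add: path_algebra_simps path_mult_minus_right path_mult_single)
  ultimately show ?thesis by simp
qed

text \<open>Both terms are additive in \<open>f\<close>, and for a single path the difference is that of the path and
  the chosen path parallel to it.\<close>

lemma diff_lift_coeffs_in_commuting_ideal:
  fixes f :: "('a, 'b) path \<Rightarrow>\<^sub>0 'k :: field"
  assumes "f \<in> carrier (path_algebra G)"
  shows "f - lift_coeffs (\<lambda>v w. coeff_between v w f) \<in> commuting_ideal G"
proof -
  interpret ideal "commuting_ideal G" "path_algebra G" by (rule ideal_commuting_ideal)
  have "Poly_Mapping.keys f \<subseteq> paths G" using assms by (simp add: path_algebra_simps)
  then show ?thesis
  proof (induction rule: poly_mapping_induct_on)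
    case zero
    have "lift_coeffs (\<lambda>v w. 0) = (0 :: ('a, 'b) path \<Rightarrow>\<^sub>0 'k)"
      by (simp add: lift_coeffs_def cong: if_cong)
    then show ?case using additive_subgroup.zero_closed[OF is_additive_subgroup]
      by (simp add: path_algebra_simps)
  next
    case (single_plus p c f)
    let ?r = "chosen_path (start p) (target p)"
    have "has_path G (start p) (target p)" using single_plus.hyps by (auto simp: has_path_def)
    then have "Poly_Mapping.single p c - Poly_Mapping.single ?r c \<in> commuting_ideal G"
      using single_plus.hyps
      by (intro parallel_difference_in_commuting_ideal) (simp_all add: parallel_def chosen_path)
    from additive_subgroup.a_closed[OF is_additive_subgroup this single_plus.IH] show ?case
      by (simp add: path_algebra_simps coeff_between_add lift_coeffs_add
          lift_coeffs_single[OF single_plus.hyps(1)] algebra_simps)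
  qed
qed

lemma commuting_idealI:
  assumes f: "f \<in> carrier (path_algebra G)"
    and zero: "\<And>v w. v \<in> verts G \<Longrightarrow> w \<in> verts G \<Longrightarrow> coeff_between v w f = 0"
  shows "f \<in> commuting_ideal G"
proof -
  have "lift_coeffs (\<lambda>v w. coeff_between v w f) = 0"
    unfolding lift_coeffs_def by (intro sum.neutral ballI) (simp add: zero)
  then show ?thesis using diff_lift_coeffs_in_commuting_ideal[OF f] by simp
qed

end

section \<open>The path algebra maps onto the display algebra\<close>

definition path_display :: "('v, 'e) pre_digraph \<Rightarrow> 'v list \<Rightarrow> display" where
  "path_display Q vs = mat (length vs) (length vs)
     (\<lambda>(k, l). if has_path Q (vs ! k) (vs ! l) then K_entry else Zero_entry)"

definition coeff_mat :: "'v list \<Rightarrow> (('v, 'e) path \<Rightarrow>\<^sub>0 'k :: field) \<Rightarrow> 'k mat" where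
  "coeff_mat vs f = mat (length vs) (length vs) (\<lambda>(k, l). coeff_between (vs ! k) (vs ! l) f)"

lemma display_algebra_simps:
  "carrier (display_algebra n B :: ('k :: field, 'k mat) module) =
     {M \<in> carrier_mat n n. \<forall>k<n. \<forall>l<n. B $$ (k, l) = Zero_entry \<longrightarrow> M $$ (k, l) = 0}"
  "monoid.mult (display_algebra n B :: ('k, 'k mat) module) = (*)"
  "one (display_algebra n B :: ('k, 'k mat) module) = 1\<^sub>m n"
  "ring.zero (display_algebra n B :: ('k, 'k mat) module) = 0\<^sub>m n n"
  "add (display_algebra n B :: ('k, 'k mat) module) = (+)"
  "module.smult (display_algebra n B :: ('k, 'k mat) module) = (\<cdot>\<^sub>m)"
  by (simp_all add: display_algebra_def matrix_algebra_def ring_mat_def module.defs)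

lemma display_carrier:
  "carrier (display_algebra (length vs) (path_display Q vs) :: ('k :: field, 'k mat) module) =
     {M \<in> carrier_mat (length vs) (length vs).
       \<forall>k<length vs. \<forall>l<length vs. \<not> has_path Q (vs ! k) (vs ! l) \<longrightarrow> M $$ (k, l) = 0}"
  by (auto simp: display_algebra_simps path_display_def)

text \<open>This exhibits the display algebra as a subset of the full matrix ring with the inherited
  operations, ready for the subring criterion.\<close>

lemma display_algebra_eq:
  "display_algebra n B = (ring_mat TYPE('k :: field) n (module.fields (\<cdot>\<^sub>m)))
     \<lparr> carrier := carrier (display_algebra n B) \<rparr>"
  by (simp add: display_algebra_def matrix_algebra_def)

context fin_digraph
begin

text \<open>Reflexivity of the path relation puts the identity matrix in this set. Transitivity closes it
  under products: if there is no path from \<open>v\<^sub>k\<close> to \<open>v\<^sub>l\<close>, then for every \<open>i\<close> one of the positions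
  \<open>(k, i)\<close> and \<open>(i, l)\<close> is a zero of the display.\<close>

lemma ring_display_algebra:
  assumes vs: "set vs = verts G"
  shows "ring (display_algebra (length vs) (path_display G vs) :: ('k :: field, 'k mat) module)"
    (is "ring ?D")
proof -
  let ?n = "length vs"
  let ?M = "ring_mat TYPE('k) ?n (module.fields (\<cdot>\<^sub>m)) :: ('k, 'k mat) module"
  interpret M: ring ?M by (rule ring_mat)
  have verts: "vs ! k \<in> verts G" if "k < ?n" for k using nth_mem[OF that] vs by simp
  have "subring (carrier ?D) ?M"
  proof (rule M.subringI)
    show "carrier ?D \<subseteq> carrier ?M" by (auto simp: display_carrier ring_mat_simps)
    show "\<one>\<^bsub>?M\<^esub> \<in> carrier ?D"
      using has_path_refl verts by (auto simp: display_carrier ring_mat_simps)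
  next
    fix A assume A: "A \<in> carrier ?D"
    then have car: "A \<in> carrier_mat ?n ?n" by (simp add: display_carrier)
    have "- A \<oplus>\<^bsub>?M\<^esub> A = \<zero>\<^bsub>?M\<^esub>" using car by (simp add: ring_mat_simps)
    then have "\<ominus>\<^bsub>?M\<^esub> A = - A" using car by (intro M.minus_equality) (simp_all add: ring_mat_simps)
    then show "\<ominus>\<^bsub>?M\<^esub> A \<in> carrier ?D" using A by (auto simp: display_carrier)
  next
    fix A B assume AB: "A \<in> carrier ?D" "B \<in> carrier ?D"
    show "A \<oplus>\<^bsub>?M\<^esub> B \<in> carrier ?D" using AB by (auto simp: display_carrier ring_mat_simps)
    have "(A * B) $$ (k, l) = 0" if kl: "k < ?n" "l < ?n" "\<not> has_path G (vs ! k) (vs ! l)" for k l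
    proof -
      have "(A * B) $$ (k, l) = (\<Sum>i<?n. A $$ (k, i) * B $$ (i, l))"
        using AB kl by (auto simp: display_carrier scalar_prod_def lessThan_atLeast0)
      also have "\<dots> = 0"
      proof (intro sum.neutral ballI)
        fix i assume "i \<in> {..<?n}"
        moreover have "\<not> has_path G (vs ! k) (vs ! i) \<or> \<not> has_path G (vs ! i) (vs ! l)"
          using has_path_trans kl(3) by blast
        ultimately show "A $$ (k, i) * B $$ (i, l) = 0"
          using AB kl by (auto simp: display_carrier)
      qed
      finally show ?thesis .
    qed
    with AB show "A \<otimes>\<^bsub>?M\<^esub> B \<in> carrier ?D" by (auto simp: display_carrier ring_mat_simps)
  qed
  from M.subring_is_ring[OF this] show ?thesis by (subst display_algebra_eq)
qed

lemma coeff_mat_ring_hom: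
  assumes vs: "set vs = verts G" "distinct vs"
  shows "ring_hom_ring (path_algebra G :: ('k :: field, ('a, 'b) path \<Rightarrow>\<^sub>0 'k) module)
    (display_algebra (length vs) (path_display G vs)) (coeff_mat vs)"
    (is "ring_hom_ring ?A ?D _")
proof (rule ring_hom_ringI[OF ring_path_algebra ring_display_algebra[OF vs(1)]])
  let ?n = "length vs"
  have bij: "bij_betw ((!) vs) {..<?n} (verts G)" using vs by (intro bij_betw_nth) auto
  fix f g :: "('a, 'b) path \<Rightarrow>\<^sub>0 'k"
  assume f: "f \<in> carrier ?A"
  then show "coeff_mat vs f \<in> carrier ?D"
    by (auto simp: display_carrier coeff_mat_def coeff_between_eq_0)
  show "coeff_mat vs (f \<otimes>\<^bsub>?A\<^esub> g) = coeff_mat vs f \<otimes>\<^bsub>?D\<^esub> coeff_mat vs g"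
  proof (rule eq_matI)
    fix k l assume "k < dim_row (coeff_mat vs f \<otimes>\<^bsub>?D\<^esub> coeff_mat vs g)"
      "l < dim_col (coeff_mat vs f \<otimes>\<^bsub>?D\<^esub> coeff_mat vs g)"
    then have kl: "k < ?n" "l < ?n" by (simp_all add: display_algebra_simps coeff_mat_def)
    have "coeff_mat vs (f \<otimes>\<^bsub>?A\<^esub> g) $$ (k, l) =
        (\<Sum>i<?n. coeff_between (vs ! k) (vs ! i) f * coeff_between (vs ! i) (vs ! l) g)"
      using kl by (simp add: coeff_mat_def path_algebra_simps coeff_between_mult[OF f]
          sum.reindex_bij_betw[OF bij, symmetric])
    also have "\<dots> = (coeff_mat vs f \<otimes>\<^bsub>?D\<^esub> coeff_mat vs g) $$ (k, l)"
      using kl by (simp add: coeff_mat_def display_algebra_simps scalar_prod_def lessThan_atLeast0)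
    finally show "coeff_mat vs (f \<otimes>\<^bsub>?A\<^esub> g) $$ (k, l) = (coeff_mat vs f \<otimes>\<^bsub>?D\<^esub> coeff_mat vs g) $$ (k, l)" .
  qed (simp_all add: coeff_mat_def display_algebra_simps)
  show "coeff_mat vs (f \<oplus>\<^bsub>?A\<^esub> g) = coeff_mat vs f \<oplus>\<^bsub>?D\<^esub> coeff_mat vs g"
    by (rule eq_matI) (simp_all add: coeff_mat_def display_algebra_simps path_algebra_simps coeff_between_add)
next
  show "coeff_mat vs \<one>\<^bsub>?A\<^esub> = \<one>\<^bsub>?D\<^esub>"
  proof (rule eq_matI)
    fix k l assume "k < dim_row \<one>\<^bsub>?D\<^esub>" "l < dim_col \<one>\<^bsub>?D\<^esub>"
    then have kl: "k < length vs" "l < length vs" by (simp_all add: display_algebra_simps)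
    have "coeff_between (vs ! k) (vs ! l) (\<one>\<^bsub>?A\<^esub>) =
       (\<Sum>v\<in>verts G. if v = vs ! k then (if k = l then 1 else 0) else 0)"
      unfolding path_algebra_simps coeff_between_sum
      using kl vs(2) by (intro sum.cong refl) (auto simp: coeff_between_single nth_eq_iff_index_eq)
    also have "\<dots> = (if k = l then 1 else 0)" using kl vs(1) nth_mem by force
    finally show "coeff_mat vs \<one>\<^bsub>?A\<^esub> $$ (k, l) = \<one>\<^bsub>?D\<^esub> $$ (k, l)"
      using kl by (simp add: coeff_mat_def display_algebra_simps)
  qed (simp_all add: coeff_mat_def display_algebra_simps)
qed

lemma coeff_mat_surj:
  assumes vs: "set vs = verts G" "distinct vs"
  shows "coeff_mat vs ` carrier (path_algebra G :: ('k :: field, ('a, 'b) path \<Rightarrow>\<^sub>0 'k) module)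
    = carrier (display_algebra (length vs) (path_display G vs))"
    (is "_ ` carrier ?A = carrier ?D")
proof
  interpret ring_hom_ring ?A ?D "coeff_mat vs" by (rule coeff_mat_ring_hom[OF vs])
  show "coeff_mat vs ` carrier ?A \<subseteq> carrier ?D" using hom_closed by blast
  show "carrier ?D \<subseteq> coeff_mat vs ` carrier ?A"
  proof
    fix M :: "'k mat" assume M: "M \<in> carrier ?D"
    (* pos v is the index of v in the list vs *)
    define pos where "pos = the_inv_into {..<length vs} ((!) vs)"
    have pos: "pos (vs ! k) = k" if "k < length vs" for k
      unfolding pos_def using that vs(2) by (intro the_inv_into_f_f inj_on_nth) auto
    let ?f = "lift_coeffs (\<lambda>v w. M $$ (pos v, pos w))"
    have entry: "coeff_between (vs ! k) (vs ! l) ?f = M $$ (k, l)" if "k < length vs" "l < length vs" for k l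
    proof (cases "has_path G (vs ! k) (vs ! l)")
      case True
      then show ?thesis using that by (simp add: coeff_between_lift_coeffs pos)
    next
      case False
      then show ?thesis using that M coeff_between_eq_0[OF lift_coeffs_closed]
        by (simp add: display_carrier)
    qed
    have "M = coeff_mat vs ?f"
      by (rule eq_matI) (use M entry in \<open>auto simp: coeff_mat_def display_carrier\<close>)
    then show "M \<in> coeff_mat vs ` carrier ?A" by (rule image_eqI) (rule lift_coeffs_closed)
  qed
qed

text \<open>The generators of \<open>C\<close> lie in the kernel because parallel paths contribute to the same position.
  The converse is \<open>commuting_idealI\<close>.\<close>

lemma coeff_mat_kernel:
  assumes vs: "set vs = verts G" "distinct vs"
  shows "a_kernel (path_algebra G :: ('k :: field, ('a, 'b) path \<Rightarrow>\<^sub>0 'k) module)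
    (display_algebra (length vs) (path_display G vs)) (coeff_mat vs) = commuting_ideal G"
    (is "a_kernel ?A ?D _ = _")
proof
  interpret ring_hom_ring ?A ?D "coeff_mat vs" by (rule coeff_mat_ring_hom[OF vs])
  show "commuting_ideal G \<subseteq> a_kernel ?A ?D (coeff_mat vs)"
    unfolding commuting_ideal_def
  proof (rule R.genideal_minimal[OF kernel_is_ideal], clarify)
    fix p q :: "('a, 'b) path" assume pq: "p \<in> paths G" "q \<in> paths G" "parallel p q"
    let ?g = "Poly_Mapping.single p (1::'k) - Poly_Mapping.single q 1"
    have "coeff_mat vs ?g = \<zero>\<^bsub>?D\<^esub>"
      by (rule eq_matI)
        (use pq(3) in \<open>simp_all add: coeff_mat_def display_algebra_simps coeff_between_minus
            coeff_between_single parallel_def\<close>)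
    moreover have "?g \<in> carrier ?A"
      by (rule subsetD[OF generators_in_path_algebra]) (use pq in blast)
    ultimately show "?g \<in> a_kernel ?A ?D (coeff_mat vs)" unfolding a_kernel_def' by blast
  qed
  show "a_kernel ?A ?D (coeff_mat vs) \<subseteq> commuting_ideal G"
  proof
    fix f assume "f \<in> a_kernel ?A ?D (coeff_mat vs)"
    then have f: "f \<in> carrier ?A" and zero: "coeff_mat vs f = 0\<^sub>m (length vs) (length vs)"
      unfolding a_kernel_def' display_algebra_simps by blast+
    have "coeff_between (vs ! k) (vs ! l) f = 0" if "k < length vs" "l < length vs" for k l
      using arg_cong[OF zero, of "\<lambda>M. M $$ (k, l)"] that by (simp add: coeff_mat_def)
    then show "f \<in> commuting_ideal G"
      using vs(1) by (intro commuting_idealI[OF f]) (metis in_set_conv_nth)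
  qed
qed

end

section \<open>The quotient algebra by a kernel\<close>

lemma quotient_algebra_simps:
  "carrier (quotient_algebra A I) = carrier (A Quot I)"
  "monoid.mult (quotient_algebra A I) = monoid.mult (A Quot I)"
  "one (quotient_algebra A I) = one (A Quot I)"
  "ring.zero (quotient_algebra A I) = ring.zero (A Quot I)"
  "add (quotient_algebra A I) = add (A Quot I)"
  "module.smult (quotient_algebra A I) = (\<lambda>c X. \<Union>x\<in>X. I +>\<^bsub>A\<^esub> (c \<odot>\<^bsub>A\<^esub> x))"
  by (simp_all add: quotient_algebra_def ring.defs module.defs)

lemma (in ring_hom_ring) image_kernel_coset:
  assumes x: "x \<in> carrier R"
  shows "h ` (a_kernel R S h +> x) = {h x}"
proof -
  have "a_kernel R S h +> x \<in> carrier (R Quot a_kernel R S h)"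
    using x unfolding FactRing_simps by auto
  then obtain y where "h ` (a_kernel R S h +> x) = {y}" using the_elem_wf by blast
  moreover from this the_elem_simp[OF x] have "y = h x" by simp
  ultimately show ?thesis by simp
qed

text \<open>The homomorphism theorem with scalars. The scalar product of a coset \<open>X\<close> is a union of cosets
  of \<open>c \<odot> x\<close> over all representatives \<open>x \<in> X\<close>; since \<open>h\<close> is constant on \<open>X\<close> and compatible with
  scalars, it sends the whole union to one element.\<close>

lemma quotient_algebra_iso:
  fixes A :: "('k, 'a) module" and S :: "('k, 'b) module"
  assumes "ring_hom_ring A S h"
    and surj: "h ` carrier A = carrier S"
    and closed: "\<And>c x. x \<in> carrier A \<Longrightarrow> c \<odot>\<^bsub>A\<^esub> x \<in> carrier A"
    and scale: "\<And>c x. x \<in> carrier A \<Longrightarrow> h (c \<odot>\<^bsub>A\<^esub> x) = c \<odot>\<^bsub>S\<^esub> h x"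
  shows "(\<lambda>X. the_elem (h ` X)) \<in> algebra_iso (quotient_algebra A (a_kernel A S h)) S"
proof -
  interpret ring_hom_ring A S h by fact
  let ?I = "a_kernel A S h"
  have "the_elem (h ` (\<Union>x\<in>X. ?I +>\<^bsub>A\<^esub> (c \<odot>\<^bsub>A\<^esub> x))) = c \<odot>\<^bsub>S\<^esub> the_elem (h ` X)"
    if X: "X \<in> carrier (A Quot ?I)" for c X
  proof -
    obtain y where y: "y \<in> carrier A" "X = ?I +>\<^bsub>A\<^esub> y" using quot_mem[OF X] by blast
    interpret I: ideal ?I A by (rule kernel_is_ideal)
    have sub: "X \<subseteq> carrier A" using R.a_r_coset_subset_G[OF I.a_subset y(1)] y(2) by simp
    have hX: "h ` X = {h y}" using image_kernel_coset[OF y(1)] y(2) by simp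
    have "h ` (?I +>\<^bsub>A\<^esub> (c \<odot>\<^bsub>A\<^esub> x)) = {c \<odot>\<^bsub>S\<^esub> h y}" if "x \<in> X" for x
    proof -
      have "x \<in> carrier A" "h x = h y" using that sub hX by auto
      then show ?thesis by (simp add: image_kernel_coset closed scale)
    qed
    moreover have "X \<noteq> {}" using hX by auto
    ultimately have "h ` (\<Union>x\<in>X. ?I +>\<^bsub>A\<^esub> (c \<odot>\<^bsub>A\<^esub> x)) = {c \<odot>\<^bsub>S\<^esub> h y}"
      by (auto simp: image_UN)
    then show ?thesis using hX by simp
  qed
  then show ?thesis
    using FactRing_iso_set[OF surj]
    by (simp add: algebra_iso_def ring_iso_def Ring.ring_hom_def quotient_algebra_simps)
qed

text \<open>Every element of the quotient is a coset \<open>I + x\<close>, and the induced map sends the product of the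
  cosets of \<open>e\<close>, \<open>x\<close> and \<open>e'\<close> to \<open>h(e) h(x) h(e')\<close>; surjectivity lets \<open>h(x)\<close> range over all
  of \<open>S\<close>.\<close>

lemma corner_image:
  fixes A :: "('k, 'a) module" and S :: "('k, 'b) module"
  assumes "ring_hom_ring A S h"
    and surj: "h ` carrier A = carrier S"
    and e: "e \<in> carrier A" "e' \<in> carrier A"
  defines "I \<equiv> a_kernel A S h"
  shows "(\<lambda>X. the_elem (h ` X)) `
      {(I +>\<^bsub>A\<^esub> e) \<otimes>\<^bsub>quotient_algebra A I\<^esub> X \<otimes>\<^bsub>quotient_algebra A I\<^esub> (I +>\<^bsub>A\<^esub> e') | X.
        X \<in> carrier (quotient_algebra A I)}
    = {h e \<otimes>\<^bsub>S\<^esub> y \<otimes>\<^bsub>S\<^esub> h e' | y. y \<in> carrier S}"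
proof -
  interpret ring_hom_ring A S h by fact
  interpret I: ideal I A unfolding I_def by (rule kernel_is_ideal)
  let ?B = "quotient_algebra A I"
  have carrier: "carrier ?B = {I +>\<^bsub>A\<^esub> x | x. x \<in> carrier A}"
    by (auto simp: quotient_algebra_simps FactRing_simps)
  have *: "the_elem (h ` ((I +>\<^bsub>A\<^esub> e) \<otimes>\<^bsub>?B\<^esub> (I +>\<^bsub>A\<^esub> x) \<otimes>\<^bsub>?B\<^esub> (I +>\<^bsub>A\<^esub> e'))) = h e \<otimes>\<^bsub>S\<^esub> h x \<otimes>\<^bsub>S\<^esub> h e'"
    if x: "x \<in> carrier A" for x
  proof -
    have "(I +>\<^bsub>A\<^esub> e) \<otimes>\<^bsub>?B\<^esub> (I +>\<^bsub>A\<^esub> x) \<otimes>\<^bsub>?B\<^esub> (I +>\<^bsub>A\<^esub> e') = I +>\<^bsub>A\<^esub> (e \<otimes>\<^bsub>A\<^esub> x \<otimes>\<^bsub>A\<^esub> e')"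
      using e x by (simp add: quotient_algebra_simps FactRing_def I.rcoset_mult_add)
    then show ?thesis using e x by (simp add: I_def)
  qed
  have "{h e \<otimes>\<^bsub>S\<^esub> y \<otimes>\<^bsub>S\<^esub> h e' | y. y \<in> carrier S} = {h e \<otimes>\<^bsub>S\<^esub> h x \<otimes>\<^bsub>S\<^esub> h e' | x. x \<in> carrier A}"
    unfolding surj[symmetric] by blast
  also have "\<dots> = (\<lambda>X. the_elem (h ` X)) ` {(I +>\<^bsub>A\<^esub> e) \<otimes>\<^bsub>?B\<^esub> X \<otimes>\<^bsub>?B\<^esub> (I +>\<^bsub>A\<^esub> e') | X. X \<in> carrier ?B}"
    unfolding carrier by (force simp: * image_iff)
  finally show ?thesis by (rule sym)
qed

section \<open>The display of the commuting algebra\<close>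

lemma coeff_mat_trivial_path:
  assumes "distinct vs" "k < length vs"
  shows "coeff_mat vs (Poly_Mapping.single (trivial_path (vs ! k)) 1) =
    mat (length vs) (length vs) (\<lambda>(i, j). if i = k \<and> j = k then 1 else 0)"
  by (rule eq_matI)
    (use assms in \<open>auto simp: coeff_mat_def coeff_between_single nth_eq_iff_index_eq\<close>)

lemma matrix_unit_corner:
  fixes M :: "'k :: field mat"
  assumes "M \<in> carrier_mat n n" "k < n" "l < n"
  shows "mat n n (\<lambda>(i, j). if i = k \<and> j = k then 1 else 0) * M *
      mat n n (\<lambda>(i, j). if i = l \<and> j = l then 1 else 0)
    = mat n n (\<lambda>(i, j). if (i, j) = (k, l) then M $$ (k, l) else 0)" (is "?E k * M * ?E l = _")
proof -
  have left: "(?E k * M) $$ (i, j) = (if i = k then M $$ (k, j) else 0)" if "i < n" "j < n" for i j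
  proof -
    have "(?E k * M) $$ (i, j) = (\<Sum>a\<in>{0..<n}. (if i = k \<and> a = k then 1 else 0) * M $$ (a, j))"
      using assms that by (simp add: scalar_prod_def)
    also have "\<dots> = (\<Sum>a\<in>{0..<n}. if a = k then (if i = k then M $$ (k, j) else 0) else 0)"
      by (intro sum.cong) auto
    finally show ?thesis using assms by simp
  qed
  have right: "(N * ?E l) $$ (i, j) = (if j = l then N $$ (i, l) else 0)"
    if "N \<in> carrier_mat n n" "i < n" "j < n" for N :: "'k mat" and i j
  proof -
    have "(N * ?E l) $$ (i, j) = (\<Sum>a\<in>{0..<n}. N $$ (i, a) * (if a = l \<and> j = l then 1 else 0))"
      using assms that by (simp add: scalar_prod_def)
    also have "\<dots> = (\<Sum>a\<in>{0..<n}. if a = l then (if j = l then N $$ (i, l) else 0) else 0)"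
      by (intro sum.cong) auto
    finally show ?thesis using assms by simp
  qed
  have car: "?E k * M \<in> carrier_mat n n" by (rule mult_carrier_mat[OF mat_carrier assms(1)])
  show ?thesis
    by (rule eq_matI) (use assms in \<open>auto simp: right[OF car] left simp del: index_mult_mat(1)\<close>)
qed

text \<open>The corner belonging to \<open>v\<^sub>k\<close> and \<open>v\<^sub>l\<close> consists of the products \<open>E\<^sub>k\<^sub>k M E\<^sub>l\<^sub>l\<close> with \<open>M\<close> in the
  display algebra. Such a product keeps only the entry of \<open>M\<close> at \<open>(k, l)\<close>, and a matrix whose other
  entries vanish equals its own product.\<close>

lemma (in fin_digraph) commuting_algebra_has_display:
  assumes vs: "set vs = verts G" "distinct vs"
  shows "has_display (commuting_algebra G :: ('k :: field, (('a, 'b) path \<Rightarrow>\<^sub>0 'k) set) module)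
    (map (vertex_class G) vs) (path_display G vs)"
proof -
  let ?A = "path_algebra G :: ('k, ('a, 'b) path \<Rightarrow>\<^sub>0 'k) module"
  let ?n = "length vs"
  let ?D = "display_algebra ?n (path_display G vs) :: ('k, 'k mat) module"
  let ?\<phi> = "\<lambda>X. the_elem (coeff_mat vs ` X)"
  note hom = coeff_mat_ring_hom[OF vs] and surj = coeff_mat_surj[OF vs]
    and kernel = coeff_mat_kernel[OF vs]
  have iso: "?\<phi> \<in> algebra_iso (commuting_algebra G) ?D"
    unfolding commuting_algebra_def kernel[symmetric]
  proof (rule quotient_algebra_iso[OF hom surj])
    fix c f assume "f \<in> carrier ?A"
    then show "c \<odot>\<^bsub>?A\<^esub> f \<in> carrier ?A"
      by (auto simp: path_algebra_simps in_keys_iff lookup_scale)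
    show "coeff_mat vs (c \<odot>\<^bsub>?A\<^esub> f) = c \<odot>\<^bsub>?D\<^esub> coeff_mat vs f"
      by (rule eq_matI)
        (simp_all add: coeff_mat_def display_algebra_simps path_algebra_simps coeff_between_scale)
  qed
  have corner: "?\<phi> ` {map (vertex_class G) vs ! k \<otimes>\<^bsub>commuting_algebra G\<^esub> x
        \<otimes>\<^bsub>commuting_algebra G\<^esub> map (vertex_class G) vs ! l | x. x \<in> carrier (commuting_algebra G)} =
      {M \<in> carrier ?D. \<forall>i<?n. \<forall>j<?n. (i, j) \<noteq> (k, l) \<longrightarrow> M $$ (i, j) = 0}" (is "?L = ?R")
    if kl: "k < ?n" "l < ?n" for k l
  proof -
    let ?e = "\<lambda>k. Poly_Mapping.single (trivial_path (vs ! k)) 1 :: ('a, 'b) path \<Rightarrow>\<^sub>0 'k"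
    let ?P = "\<lambda>M. mat ?n ?n (\<lambda>(i, j). if (i, j) = (k, l) then M $$ (k, l) else 0) :: 'k mat"
    have e: "?e k \<in> carrier ?A" if "k < ?n" for k
      using nth_mem[OF that] vs(1) by (intro single_in_path_algebra trivial_path_in_paths) simp
    have "?L = {coeff_mat vs (?e k) \<otimes>\<^bsub>?D\<^esub> M \<otimes>\<^bsub>?D\<^esub> coeff_mat vs (?e l) | M. M \<in> carrier ?D}"
      using corner_image[OF hom surj e[OF kl(1)] e[OF kl(2)]] kl
      by (simp add: kernel commuting_algebra_def vertex_class_def)
    also have "\<dots> = {?P M | M. M \<in> carrier ?D}"
    proof -
      have eq: "coeff_mat vs (?e k) \<otimes>\<^bsub>?D\<^esub> M \<otimes>\<^bsub>?D\<^esub> coeff_mat vs (?e l) = ?P M" if "M \<in> carrier ?D" for M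
        using that kl matrix_unit_corner[of M ?n k l]
        by (simp add: display_algebra_simps coeff_mat_trivial_path[OF vs(2)])
      show ?thesis unfolding Setcompr_eq_image by (intro image_cong refl eq)
    qed
    also have "\<dots> = ?R"
    proof
      show "{?P M | M. M \<in> carrier ?D} \<subseteq> ?R" using kl by (auto simp: display_carrier)
      show "?R \<subseteq> {?P M | M. M \<in> carrier ?D}"
      proof
        fix M assume M: "M \<in> ?R"
        have "M = ?P M" by (rule eq_matI) (use M in \<open>auto simp: display_carrier\<close>)
        then show "M \<in> {?P M | M. M \<in> carrier ?D}" using M by blast
      qed
    qed
    finally show ?thesis .
  qed
  show ?thesis unfolding has_display_def length_map
  proof (intro conjI bexI[OF _ iso] allI impI)
    show "path_display G vs \<in> carrier_mat ?n ?n" by (simp add: path_display_def)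
  qed (rule corner)
qed

section \<open>The block form\<close>

context fin_digraph
begin

lemma equiv_path_connected_rel: "equiv (verts G) (path_connected_rel G)"
  by (rule equivI)
    (auto simp: path_connected_rel_def refl_on_def sym_def trans_def has_path_refl
      intro: has_path_trans)

lemma component_subset: "X \<in> path_connected_components G \<Longrightarrow> X \<subseteq> verts G"
  unfolding path_connected_components_def
  using Union_quotient[OF equiv_path_connected_rel] by blast

lemma has_path_in_component:
  assumes "X \<in> path_connected_components G" "v \<in> X" "w \<in> X"
  shows "has_path G v w"
  using quotient_eqI[OF equiv_path_connected_rel] assms
    quotient_eq_iff[OF equiv_path_connected_rel, of X X v w]
  by (auto simp: path_connected_components_def path_connected_rel_def)

text \<open>A path from \<open>v\<close> to \<open>w\<close> extends at both ends inside the components, from \<open>v'\<close> to \<open>v\<close> and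
  from \<open>w\<close> to \<open>w'\<close>.\<close>

lemma has_path_between_components:
  assumes "X \<in> path_connected_components G" "Y \<in> path_connected_components G"
    and "v \<in> X" "w \<in> Y" "has_path G v w" "v' \<in> X" "w' \<in> Y"
  shows "has_path G v' w'"
  using assms has_path_in_component has_path_trans by blast

text \<open>The components partition the vertices, so the blocks fill the whole \<open>n \<times> n\<close> display.\<close>

lemma sum_list_card_components:
  assumes "distinct D" "set D = path_connected_components G"
  shows "sum_list (map card D) = card (verts G)"
proof -
  let ?C = "verts G // path_connected_rel G"
  have "finite X" if "X \<in> ?C" for X
    using component_subset that finite_subset[OF _ finite_verts]
    unfolding path_connected_components_def by blast
  moreover have "pairwise disjnt ?C"
    using quotient_disj[OF equiv_path_connected_rel] unfolding pairwise_def disjnt_def by blast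
  ultimately have "card (\<Union> ?C) = (\<Sum>X\<in>?C. card X)" by (intro card_Union_disjoint)
  also have "\<dots> = sum_list (map card D)"
    using assms by (simp add: sum_list_distinct_conv_sum_set path_connected_components_def)
  finally show ?thesis by (simp add: Union_quotient[OF equiv_path_connected_rel])
qed

end

lemma offset_Suc_le_sum_list: "i < length ds \<Longrightarrow> offset ds (Suc i) \<le> sum_list ds"
  unfolding offset_def sum_list_sum_nth by (intro sum_mono2) auto

lemma block_path_display:
  assumes len: "sum_list ds = length vs" and ij: "i < length ds" "j < length ds"
    and X: "\<And>k. offset ds i \<le> k \<Longrightarrow> k < offset ds (Suc i) \<Longrightarrow> vs ! k \<in> X"
    and Y: "\<And>k. offset ds j \<le> k \<Longrightarrow> k < offset ds (Suc j) \<Longrightarrow> vs ! k \<in> Y"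
  shows "(\<forall>v\<in>X. \<forall>w\<in>Y. has_path Q v w) \<Longrightarrow>
      block ds (path_display Q vs) i j = all_K (ds ! i) (ds ! j)"
    and "(\<forall>v\<in>X. \<forall>w\<in>Y. \<not> has_path Q v w) \<Longrightarrow>
      block ds (path_display Q vs) i j = all_zero (ds ! i) (ds ! j)"
proof -
  have Suc: "offset ds (Suc i) = offset ds i + ds ! i" for i by (simp add: offset_def)
  have entry: "path_display Q vs $$ (offset ds i + a, offset ds j + b) =
      (if has_path Q (vs ! (offset ds i + a)) (vs ! (offset ds j + b)) then K_entry else Zero_entry)"
    if "a < ds ! i" "b < ds ! j" for a b
    using that offset_Suc_le_sum_list[OF ij(1)] offset_Suc_le_sum_list[OF ij(2)]
    by (simp add: path_display_def Suc len)
  have X': "vs ! (offset ds i + a) \<in> X" if "a < ds ! i" for a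
    using that by (intro X) (simp_all add: Suc)
  have Y': "vs ! (offset ds j + b) \<in> Y" if "b < ds ! j" for b
    using that by (intro Y) (simp_all add: Suc)
  show "block ds (path_display Q vs) i j = all_K (ds ! i) (ds ! j)"
    if "\<forall>v\<in>X. \<forall>w\<in>Y. has_path Q v w"
    unfolding block_def all_K_def by (rule cong_mat) (simp_all add: entry that X' Y')
  show "block ds (path_display Q vs) i j = all_zero (ds ! i) (ds ! j)"
    if "\<forall>v\<in>X. \<forall>w\<in>Y. \<not> has_path Q v w"
    unfolding block_def all_zero_def by (rule cong_mat) (simp_all add: entry that X' Y')
qed

theorem theorem4p4:
  fixes Q :: "('v, 'e) pre_digraph"
    and n m :: nat
    and vs :: "'v list"
    and D :: "'v set list"
    and d :: "nat list"
  assumes quiver: "fin_digraph Q"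
    and vertices: "distinct vs" "set vs = verts Q" "length vs = n"
    and components: "distinct D" "set D = path_connected_components Q" "length D = m"
    and sizes: "d = map card D"
    and ordered: "\<forall>i<m. (\<lambda>k. vs ! k) ` {offset d i..<offset d (Suc i)} = D ! i"
  shows "\<exists>B. block_form d B \<and>
    has_display (commuting_algebra Q :: ('k :: field, (('v, 'e) path \<Rightarrow>\<^sub>0 'k) set) module)
      (map (vertex_class Q) vs) B \<and>
    (\<forall>i<m. \<forall>j<m.
      ((\<exists>v\<in>D ! i. \<exists>w\<in>D ! j. has_path Q v w) \<longrightarrow> block d B i j = all_K (d ! i) (d ! j)) \<and>
      ((\<forall>v\<in>D ! i. \<forall>w\<in>D ! j. \<not> has_path Q v w) \<longrightarrow> block d B i j = all_zero (d ! i) (d ! j)))"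
proof -
  interpret fin_digraph Q by (rule quiver)
  let ?B = "path_display Q vs"
  have len: "sum_list d = length vs"
    unfolding sizes sum_list_card_components[OF components(1,2)]
    unfolding vertices(2)[symmetric] by (rule distinct_card[OF vertices(1)])
  have comp: "D ! i \<in> path_connected_components Q" if "i < m" for i
    using nth_mem[of i D] that components(2,3) by simp
  have mem: "vs ! k \<in> D ! i" if "i < m" "offset d i \<le> k" "k < offset d (Suc i)" for i k
    using ordered that by force
  have length_d: "length d = m" using sizes components(3) by simp
  have all: "block d ?B i j = all_K (d ! i) (d ! j)"
    if "i < m" "j < m" "\<forall>v\<in>D ! i. \<forall>w\<in>D ! j. has_path Q v w" for i j
    using that length_d mem by (intro block_path_display(1)[OF len, of i j "D ! i" "D ! j"]) auto
  have none: "block d ?B i j = all_zero (d ! i) (d ! j)"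
    if "i < m" "j < m" "\<forall>v\<in>D ! i. \<forall>w\<in>D ! j. \<not> has_path Q v w" for i j
    using that length_d mem by (intro block_path_display(2)[OF len, of i j "D ! i" "D ! j"]) auto
  have some: "block d ?B i j = all_K (d ! i) (d ! j)"
    if "i < m" "j < m" "\<exists>v\<in>D ! i. \<exists>w\<in>D ! j. has_path Q v w" for i j
    using that all has_path_between_components[OF comp comp] by blast
  have "block d ?B i i = all_K (d ! i) (d ! i)" if "i < m" for i
    using that all has_path_in_component[OF comp] by blast
  then have "block_form d ?B"
    unfolding block_form_def length_d len
  proof (intro conjI allI impI)
    show "?B \<in> carrier_mat (length vs) (length vs)" by (simp add: path_display_def)
  next
    fix i j assume "i < m" "j < m"
    then show "block d ?B i j = all_K (d ! i) (d ! j) \<or> block d ?B i j = all_zero (d ! i) (d ! j)"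
      using some none by blast
  qed
  moreover have "has_display (commuting_algebra Q :: ('k, (('v, 'e) path \<Rightarrow>\<^sub>0 'k) set) module)
      (map (vertex_class Q) vs) ?B"
    by (rule commuting_algebra_has_display[OF vertices(2,1)])
  ultimately show ?thesis using some none by blast
qed

end
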